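(* Let $A$ be a unital associative algebra and $V$ a (not necessarily unital) associative algebra over a field $k$. Then a unital associative algebra $E$ factorizes through $A$ and $V$ if and only if there exists a matched pair of algebras $(A,V,\triangleleft,\triangleright,\leftharpoonup,\rightharpoonup)$ such that $E\cong A\bowtie V$ as algebras.
   Context: All vector spaces, linear and bilinear maps are over an arbitrary field $k$. A unital algebra $E$ factorizes through $A$ and $V$ if $E$ contains $A$ and $V$ (up to identification with isomorphic copies) as subalgebras, $A$ as a unital subalgebra and $V$ as a not necessarily unital one, such that $E=A+V$ and $A\cap V=\{0\}$. A matched pair of algebras is a system $(A,V,\triangleleft,\triangleright,\leftharpoonup,\rightharpoonup)$ consisting of a unital associative algebra $A$, a not necessarily unital associative algebra $V=(V,\cdot)$ and bilinear maps $\triangleleft:V\times A\to V$, $\triangleright:V\times A\to A$, $\leftharpoonup:A\times V\to A$, $\rightharpoonup:A\times V\to V$ such that $(V,\rightharpoonup,\triangleleft)$ is a (unital) $A$-bimodule, $(A,\triangleright,\leftharpoonup)$ is a $V$-bimodule (no unit condition; left action $\triangleright$, right action $\leftharpoonup$) and for all $a,b\in A$, $x,y\in V$: (MP1) $a\rightharpoonup(x\cdot y)=(a\rightharpoonup x)\cdot y+(a\leftharpoonup x)\rightharpoonup y$; (MP2) $(ab)\leftharpoonup x=a(b\leftharpoonup x)+a\leftharpoonup(b\rightharpoonup x)$; (MP3) $x\triangleright(ab)=(x\triangleright a)b+(x\triangleleft a)\triangleright b$; (MP4) $(x\cdot y)\triangleleft a=x\triangleleft(y\triangleright a)+x\cdot(y\triangleleft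 a)$; (MP5) $a(x\triangleright b)+a\leftharpoonup(x\triangleleft b)=(a\leftharpoonup x)b+(a\rightharpoonup x)\triangleright b$; (MP6) $x\triangleleft(a\leftharpoonup y)+x\cdot(a\rightharpoonup y)=(x\triangleright a)\rightharpoonup y+(x\triangleleft a)\cdot y$. The bicrossed product $A\bowtie V$ is the vector space $A\times V$ with the (associative, with unit $(1_A,0)$) multiplication $$(a,x)\bullet(b,y)=\bigl(ab+a\leftharpoonup y+x\triangleright b,\ a\rightharpoonup y+x\triangleleft b+x\cdot y\bigr).$$ *)

theory Defs
  imports "HOL-Analysis.Product_Vector"
begin

(* Algebras are given by explicit operations on a whole type: the multiplication of A \<bowtie> V is not a
   class operation on the product type, and class ring_1 would exclude the zero algebra. *)

definition bilinear_map ::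
  "('k::field \<Rightarrow> 'a \<Rightarrow> 'a::ab_group_add) \<Rightarrow> ('k \<Rightarrow> 'b \<Rightarrow> 'b::ab_group_add) \<Rightarrow>
   ('k \<Rightarrow> 'c \<Rightarrow> 'c::ab_group_add) \<Rightarrow> ('a \<Rightarrow> 'b \<Rightarrow> 'c) \<Rightarrow> bool"
  where "bilinear_map s1 s2 s3 f \<longleftrightarrow>
    (\<forall>x. Vector_Spaces.linear s2 s3 (\<lambda>y. f x y)) \<and> (\<forall>y. Vector_Spaces.linear s1 s3 (\<lambda>x. f x y))"

locale assoc_algebra = vector_space scale + semigroup mult
  for scale :: "'k::field \<Rightarrow> 'a::ab_group_add \<Rightarrow> 'a" and mult :: "'a \<Rightarrow> 'a \<Rightarrow> 'a" +
  assumes bilinear_mult: "bilinear_map scale scale scale mult"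

locale unital_assoc_algebra = assoc_algebra scale mult + monoid mult one
  for scale :: "'k::field \<Rightarrow> 'a::ab_group_add \<Rightarrow> 'a" and mult :: "'a \<Rightarrow> 'a \<Rightarrow> 'a" and one :: 'a

definition subalgebra ::
  "('k::field \<Rightarrow> 'a \<Rightarrow> 'a::ab_group_add) \<Rightarrow> ('a \<Rightarrow> 'a \<Rightarrow> 'a) \<Rightarrow> 'a set \<Rightarrow> bool"
  where "subalgebra s m B \<longleftrightarrow> module.subspace s B \<and> (\<forall>x\<in>B. \<forall>y\<in>B. m x y \<in> B)"

definition unital_subalgebra ::
  "('k::field \<Rightarrow> 'a \<Rightarrow> 'a::ab_group_add) \<Rightarrow> ('a \<Rightarrow> 'a \<Rightarrow> 'a) \<Rightarrow> 'a \<Rightarrow> 'a set \<Rightarrow> bool"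
  where "unital_subalgebra s m e B \<longleftrightarrow> subalgebra s m B \<and> e \<in> B"

definition algebra_hom ::
  "('k::field \<Rightarrow> 'a \<Rightarrow> 'a::ab_group_add) \<Rightarrow> ('a \<Rightarrow> 'a \<Rightarrow> 'a) \<Rightarrow>
   ('k \<Rightarrow> 'b \<Rightarrow> 'b::ab_group_add) \<Rightarrow> ('b \<Rightarrow> 'b \<Rightarrow> 'b) \<Rightarrow> ('a \<Rightarrow> 'b) \<Rightarrow> bool"
  where "algebra_hom s1 m1 s2 m2 f \<longleftrightarrow>
    Vector_Spaces.linear s1 s2 f \<and> (\<forall>x y. f (m1 x y) = m2 (f x) (f y))"

definition unital_algebra_hom ::
  "('k::field \<Rightarrow> 'a \<Rightarrow> 'a::ab_group_add) \<Rightarrow> ('a \<Rightarrow> 'a \<Rightarrow> 'a) \<Rightarrow> 'a \<Rightarrow>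
   ('k \<Rightarrow> 'b \<Rightarrow> 'b::ab_group_add) \<Rightarrow> ('b \<Rightarrow> 'b \<Rightarrow> 'b) \<Rightarrow> 'b \<Rightarrow> ('a \<Rightarrow> 'b) \<Rightarrow> bool"
  where "unital_algebra_hom s1 m1 e1 s2 m2 e2 f \<longleftrightarrow>
    algebra_hom s1 m1 s2 m2 f \<and> f e1 = e2"

definition unital_algebra_isomorphic ::
  "('k::field \<Rightarrow> 'a \<Rightarrow> 'a::ab_group_add) \<Rightarrow> ('a \<Rightarrow> 'a \<Rightarrow> 'a) \<Rightarrow> 'a \<Rightarrow>
   ('k \<Rightarrow> 'b \<Rightarrow> 'b::ab_group_add) \<Rightarrow> ('b \<Rightarrow> 'b \<Rightarrow> 'b) \<Rightarrow> 'b \<Rightarrow> bool"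
  where "unital_algebra_isomorphic s1 m1 e1 s2 m2 e2 \<longleftrightarrow>
    (\<exists>f. unital_algebra_hom s1 m1 e1 s2 m2 e2 f \<and> bij f)"

(* B and W are the copies of A and V inside E. *)
definition factorizes_through ::
  "('k::field \<Rightarrow> 'e \<Rightarrow> 'e::ab_group_add) \<Rightarrow> ('e \<Rightarrow> 'e \<Rightarrow> 'e) \<Rightarrow> 'e \<Rightarrow>
   ('k \<Rightarrow> 'a \<Rightarrow> 'a::ab_group_add) \<Rightarrow> ('a \<Rightarrow> 'a \<Rightarrow> 'a) \<Rightarrow> 'a \<Rightarrow>
   ('k \<Rightarrow> 'v \<Rightarrow> 'v::ab_group_add) \<Rightarrow> ('v \<Rightarrow> 'v \<Rightarrow> 'v) \<Rightarrow> bool"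
  where "factorizes_through sE mE oneE sA mA oneA sV mV \<longleftrightarrow>
    (\<exists>B W. unital_subalgebra sE mE oneE B \<and> subalgebra sE mE W \<and>
       (\<exists>i. unital_algebra_hom sA mA oneA sE mE oneE i \<and> bij_betw i UNIV B) \<and>
       (\<exists>j. algebra_hom sV mV sE mE j \<and> bij_betw j UNIV W) \<and>
       {b + w |b w. b \<in> B \<and> w \<in> W} = UNIV \<and> B \<inter> W = {0})"

locale bimodule = R: assoc_algebra sR mR + M: vector_space sM
  for sR :: "'k::field \<Rightarrow> 'r::ab_group_add \<Rightarrow> 'r" and mR :: "'r \<Rightarrow> 'r \<Rightarrow> 'r"
    and sM :: "'k \<Rightarrow> 'm::ab_group_add \<Rightarrow> 'm" +
  fixes left_act :: "'r \<Rightarrow> 'm \<Rightarrow> 'm" and right_act :: "'m \<Rightarrow> 'r \<Rightarrow> 'm"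
  assumes bilinear_left: "bilinear_map sR sM sM left_act"
    and bilinear_right: "bilinear_map sM sR sM right_act"
    and left_assoc: "left_act (mR r s) m = left_act r (left_act s m)"
    and right_assoc: "right_act m (mR r s) = right_act (right_act m r) s"
    and left_right_assoc: "right_act (left_act r m) s = left_act r (right_act m s)"

locale unital_bimodule = bimodule sR mR sM left_act right_act + R: unital_assoc_algebra sR mR oneR
  for sR :: "'k::field \<Rightarrow> 'r::ab_group_add \<Rightarrow> 'r" and mR :: "'r \<Rightarrow> 'r \<Rightarrow> 'r" and oneR :: 'r
    and sM :: "'k \<Rightarrow> 'm::ab_group_add \<Rightarrow> 'm"
    and left_act :: "'r \<Rightarrow> 'm \<Rightarrow> 'm" and right_act :: "'m \<Rightarrow> 'r \<Rightarrow> 'm" +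
  assumes left_one: "left_act oneR m = m"
    and right_one: "right_act m oneR = m"

locale matched_pair =
  A: unital_assoc_algebra sA mA oneA + V: assoc_algebra sV mV +
  AV: unital_bimodule sA mA oneA sV hright tleft +
  VA: bimodule sV mV sA tright hleft
  for sA :: "'k::field \<Rightarrow> 'a::ab_group_add \<Rightarrow> 'a" and mA :: "'a \<Rightarrow> 'a \<Rightarrow> 'a" (infixl \<open>\<odot>\<close> 70)
    and oneA :: 'a
    and sV :: "'k \<Rightarrow> 'v::ab_group_add \<Rightarrow> 'v" and mV :: "'v \<Rightarrow> 'v \<Rightarrow> 'v" (infixl \<open>\<cdot>\<close> 70)
    and tleft :: "'v \<Rightarrow> 'a \<Rightarrow> 'v" (infixl \<open>\<triangleleft>\<close> 70)
    and tright :: "'v \<Rightarrow> 'a \<Rightarrow> 'a" (infixl \<open>\<triangleright>\<close> 70)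
    and hleft :: "'a \<Rightarrow> 'v \<Rightarrow> 'a" (infixl \<open>\<leftharpoonup>\<close> 70)
    and hright :: "'a \<Rightarrow> 'v \<Rightarrow> 'v" (infixl \<open>\<rightharpoonup>\<close> 70) +
  assumes MP1: "a \<rightharpoonup> (x \<cdot> y) = (a \<rightharpoonup> x) \<cdot> y + (a \<leftharpoonup> x) \<rightharpoonup> y"
    and MP2: "(a \<odot> b) \<leftharpoonup> x = a \<odot> (b \<leftharpoonup> x) + a \<leftharpoonup> (b \<rightharpoonup> x)"
    and MP3: "x \<triangleright> (a \<odot> b) = (x \<triangleright> a) \<odot> b + (x \<triangleleft> a) \<triangleright> b"
    and MP4: "(x \<cdot> y) \<triangleleft> a = x \<triangleleft> (y \<triangleright> a) + x \<cdot> (y \<triangleleft> a)"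
    and MP5: "a \<odot> (x \<triangleright> b) + a \<leftharpoonup> (x \<triangleleft> b) = (a \<leftharpoonup> x) \<odot> b + (a \<rightharpoonup> x) \<triangleright> b"
    and MP6: "x \<triangleleft> (a \<leftharpoonup> y) + x \<cdot> (a \<rightharpoonup> y) = (x \<triangleright> a) \<rightharpoonup> y + (x \<triangleleft> a) \<cdot> y"

(* The bicrossed product has the componentwise scalar multiplication module_prod.scale sA sV,
   the following multiplication, and unit (oneA, 0). *)
definition bicrossed_mult ::
  "('a::ab_group_add \<Rightarrow> 'a \<Rightarrow> 'a) \<Rightarrow> ('v::ab_group_add \<Rightarrow> 'v \<Rightarrow> 'v) \<Rightarrow>
   ('v \<Rightarrow> 'a \<Rightarrow> 'v) \<Rightarrow> ('v \<Rightarrow> 'a \<Rightarrow> 'a) \<Rightarrow> ('a \<Rightarrow> 'v \<Rightarrow> 'a) \<Rightarrow> ('a \<Rightarrow> 'v \<Rightarrow> 'v) \<Rightarrow>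
   'a \<times> 'v \<Rightarrow> 'a \<times> 'v \<Rightarrow> 'a \<times> 'v"
  where "bicrossed_mult mA mV tleft tright hleft hright = (\<lambda>(a, x) (b, y).
    (mA a b + hleft a y + tright x b, hright a y + tleft x b + mV x y))"

end

theory Submission
  imports Defs
begin

text \<open>
  A factorization of \<open>E\<close> amounts to algebra maps \<open>i\<close> from \<open>A\<close> and \<open>j\<close> from \<open>V\<close> for which
  \<open>(a, x) \<mapsto> i a + j x\<close> is a linear bijection. Decomposing the mixed products \<open>i a * j x\<close> and
  \<open>j x * i a\<close> along it defines the four actions, and \<open>(a, x) \<mapsto> i a + j x\<close> is then multiplicative
  on the bicrossed product. Associativity in \<open>E\<close> of the six mixed kinds of triple products yields,
  by comparing the two components, the bimodule laws and the matched pair axioms.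
  Conversely, the summands \<open>A \<times> 0\<close> and \<open>0 \<times> V\<close> of a bicrossed product are subalgebras.
\<close>

text \<open>Linearity in each argument becomes plain equations; the vector space conditions remain
  because \<open>Vector_Spaces.linear\<close> includes them.\<close>

lemma bilinear_map_iff:
  "bilinear_map s1 s2 s3 f \<longleftrightarrow>
    vector_space s1 \<and> vector_space s2 \<and> vector_space s3 \<and>
    (\<forall>x x' y. f (x + x') y = f x y + f x' y) \<and> (\<forall>c x y. f (s1 c x) y = s3 c (f x y)) \<and>
    (\<forall>x y y'. f x (y + y') = f x y + f x y') \<and> (\<forall>c x y. f x (s2 c y) = s3 c (f x y))"
  unfolding bilinear_map_def Vector_Spaces.linear_iff by blast

lemma bilinear_map_zero:
  assumes "bilinear_map s1 s2 s3 f"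
  shows "f 0 y = 0" and "f x 0 = 0"
  using assms unfolding bilinear_map_iff by (metis add_cancel_right_right)+

section \<open>From a splitting of \<open>E\<close> to a matched pair\<close>

locale algebra_splitting =
  A: unital_assoc_algebra sA mA oneA + V: assoc_algebra sV mV +
  E: unital_assoc_algebra sE mE oneE
  for sA :: "'k::field \<Rightarrow> 'a::ab_group_add \<Rightarrow> 'a" and mA :: "'a \<Rightarrow> 'a \<Rightarrow> 'a" and oneA :: 'a
    and sV :: "'k \<Rightarrow> 'v::ab_group_add \<Rightarrow> 'v" and mV :: "'v \<Rightarrow> 'v \<Rightarrow> 'v"
    and sE :: "'k \<Rightarrow> 'e::ab_group_add \<Rightarrow> 'e" and mE :: "'e \<Rightarrow> 'e \<Rightarrow> 'e" (infixl \<open>*\<^sub>E\<close> 70)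
    and oneE :: 'e +
  fixes i :: "'a \<Rightarrow> 'e" and j :: "'v \<Rightarrow> 'e"
  assumes hom_i: "unital_algebra_hom sA mA oneA sE mE oneE i"
    and hom_j: "algebra_hom sV mV sE mE j"
    and bij_sum: "bij (\<lambda>(a, x). i a + j x)"
begin

text \<open>The coordinates are taken in \<open>A\<close> and \<open>V\<close> themselves, not in
  their copies inside \<open>E\<close>, so that the actions defined from them have the types of a
  matched pair.\<close>

definition proj_A :: "'e \<Rightarrow> 'a" where "proj_A e = fst (inv (\<lambda>(a, x). i a + j x) e)"
definition proj_V :: "'e \<Rightarrow> 'v" where "proj_V e = snd (inv (\<lambda>(a, x). i a + j x) e)"

definition tleft :: "'v \<Rightarrow> 'a \<Rightarrow> 'v" where "tleft x a = proj_V (j x *\<^sub>E i a)"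
definition tright :: "'v \<Rightarrow> 'a \<Rightarrow> 'a" where "tright x a = proj_A (j x *\<^sub>E i a)"
definition hleft :: "'a \<Rightarrow> 'v \<Rightarrow> 'a" where "hleft a x = proj_A (i a *\<^sub>E j x)"
definition hright :: "'a \<Rightarrow> 'v \<Rightarrow> 'v" where "hright a x = proj_V (i a *\<^sub>E j x)"

lemma i_simps: "i (a + b) = i a + i b" "i (sA c a) = sE c (i a)" "i (mA a b) = i a *\<^sub>E i b" "i oneA = oneE"
  using hom_i unfolding unital_algebra_hom_def algebra_hom_def Vector_Spaces.linear_iff by auto

lemma j_simps: "j (x + y) = j x + j y" "j (sV c x) = sE c (j x)" "j (mV x y) = j x *\<^sub>E j y"
  using hom_j unfolding algebra_hom_def Vector_Spaces.linear_iff by auto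

lemma i_zero [simp]: "i 0 = 0" and j_zero [simp]: "j 0 = 0"
  using i_simps(1)[of 0 0] j_simps(1)[of 0 0] by simp_all

lemma mE_simps:
  "(x + y) *\<^sub>E z = x *\<^sub>E z + y *\<^sub>E z" "sE c x *\<^sub>E z = sE c (x *\<^sub>E z)"
  "x *\<^sub>E (y + z) = x *\<^sub>E y + x *\<^sub>E z" "x *\<^sub>E sE c z = sE c (x *\<^sub>E z)"
  using E.bilinear_mult unfolding bilinear_map_iff by auto

text \<open>Injectivity of the sum map. This is what splits each equation in \<open>E\<close> into
  one equation in \<open>A\<close> and one in \<open>V\<close>.\<close>

lemma sum_eq_iff: "i a + j x = i b + j y \<longleftrightarrow> a = b \<and> x = y"
  using bij_is_inj[OF bij_sum] by (auto dest: injD[of _ "(a, x)" "(b, y)"])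

lemma sum_proj: "i (proj_A e) + j (proj_V e) = e"
  using surj_f_inv_f[OF bij_is_surj[OF bij_sum], of e]
  by (simp add: proj_A_def proj_V_def case_prod_beta)

lemma ji_mult: "j x *\<^sub>E i a = i (tright x a) + j (tleft x a)"
  by (simp add: tright_def tleft_def sum_proj)

lemma ij_mult: "i a *\<^sub>E j x = i (hleft a x) + j (hright a x)"
  by (simp add: hleft_def hright_def sum_proj)

text \<open>The letters in the name give the order of embedded factors: here \<open>i a\<close>,
  \<open>i b\<close>, \<open>j x\<close>. The \<open>A\<close>-component is \<open>MP2\<close>, the
  \<open>V\<close>-component the left module law of \<open>hright\<close>.\<close>

lemma mixed_iij:
  "hleft (mA a b) x = mA a (hleft b x) + hleft a (hright b x)"
  "hright (mA a b) x = hright a (hright b x)"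
proof -
  have "i (hleft (mA a b) x) + j (hright (mA a b) x) = i a *\<^sub>E (i b *\<^sub>E j x)"
    by (simp add: ij_mult[symmetric] i_simps E.assoc)
  also have "\<dots> = i (mA a (hleft b x) + hleft a (hright b x)) + j (hright a (hright b x))"
    by (simp add: ij_mult mE_simps i_simps ac_simps)
  finally show "hleft (mA a b) x = mA a (hleft b x) + hleft a (hright b x)"
    "hright (mA a b) x = hright a (hright b x)"
    by (simp_all add: sum_eq_iff)
qed

text \<open>The \<open>A\<close>-component is \<open>MP5\<close>; the \<open>V\<close>-component
  says that the two actions of \<open>A\<close> on \<open>V\<close> commute.\<close>

lemma mixed_iji:
  "mA a (tright x b) + hleft a (tleft x b) = mA (hleft a x) b + tright (hright a x) b"
  "hright a (tleft x b) = tleft (hright a x) b"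
proof -
  have "i (mA a (tright x b) + hleft a (tleft x b)) + j (hright a (tleft x b)) = i a *\<^sub>E (j x *\<^sub>E i b)"
    by (simp add: ij_mult ji_mult mE_simps i_simps ac_simps)
  also have "\<dots> = (i a *\<^sub>E j x) *\<^sub>E i b"
    by (simp only: E.assoc)
  also have "\<dots> = i (mA (hleft a x) b + tright (hright a x) b) + j (tleft (hright a x) b)"
    by (simp add: ij_mult ji_mult mE_simps i_simps ac_simps)
  finally show "mA a (tright x b) + hleft a (tleft x b) = mA (hleft a x) b + tright (hright a x) b"
    "hright a (tleft x b) = tleft (hright a x) b"
    by (simp_all add: sum_eq_iff)
qed

text \<open>The \<open>A\<close>-component is \<open>MP3\<close>, the \<open>V\<close>-component the
  right module law of \<open>tleft\<close>.\<close>

lemma mixed_jii: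
  "tright x (mA a b) = mA (tright x a) b + tright (tleft x a) b"
  "tleft x (mA a b) = tleft (tleft x a) b"
proof -
  have "i (tright x (mA a b)) + j (tleft x (mA a b)) = (j x *\<^sub>E i a) *\<^sub>E i b"
    by (simp add: ji_mult[symmetric] i_simps E.assoc)
  also have "\<dots> = i (mA (tright x a) b + tright (tleft x a) b) + j (tleft (tleft x a) b)"
    by (simp add: ji_mult mE_simps i_simps ac_simps)
  finally show "tright x (mA a b) = mA (tright x a) b + tright (tleft x a) b"
    "tleft x (mA a b) = tleft (tleft x a) b"
    by (simp_all add: sum_eq_iff)
qed

text \<open>The \<open>A\<close>-component is the right module law of \<open>hleft\<close>, the
  \<open>V\<close>-component \<open>MP1\<close>.\<close>

lemma mixed_ijj:
  "hleft a (mV x y) = hleft (hleft a x) y"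
  "hright a (mV x y) = mV (hright a x) y + hright (hleft a x) y"
proof -
  have "i (hleft a (mV x y)) + j (hright a (mV x y)) = (i a *\<^sub>E j x) *\<^sub>E j y"
    by (simp add: ij_mult[symmetric] j_simps E.assoc)
  also have "\<dots> = i (hleft (hleft a x) y) + j (mV (hright a x) y + hright (hleft a x) y)"
    by (simp add: ij_mult mE_simps j_simps ac_simps)
  finally show "hleft a (mV x y) = hleft (hleft a x) y"
    "hright a (mV x y) = mV (hright a x) y + hright (hleft a x) y"
    by (simp_all add: sum_eq_iff)
qed

text \<open>The \<open>A\<close>-component says that the two actions of \<open>V\<close> on
  \<open>A\<close> commute; the \<open>V\<close>-component is \<open>MP6\<close>.\<close>

lemma mixed_jij:
  "tright x (hleft a y) = hleft (tright x a) y"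
  "tleft x (hleft a y) + mV x (hright a y) = hright (tright x a) y + mV (tleft x a) y"
proof -
  have "i (tright x (hleft a y)) + j (tleft x (hleft a y) + mV x (hright a y)) = j x *\<^sub>E (i a *\<^sub>E j y)"
    by (simp add: ij_mult ji_mult mE_simps j_simps ac_simps)
  also have "\<dots> = (j x *\<^sub>E i a) *\<^sub>E j y"
    by (simp only: E.assoc)
  also have "\<dots> = i (hleft (tright x a) y) + j (hright (tright x a) y + mV (tleft x a) y)"
    by (simp add: ij_mult ji_mult mE_simps j_simps ac_simps)
  finally show "tright x (hleft a y) = hleft (tright x a) y"
    "tleft x (hleft a y) + mV x (hright a y) = hright (tright x a) y + mV (tleft x a) y"
    by (simp_all add: sum_eq_iff)
qed

text \<open>The \<open>A\<close>-component is the left module law of \<open>tright\<close>, the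
  \<open>V\<close>-component \<open>MP4\<close>.\<close>

lemma mixed_jji:
  "tright (mV x y) a = tright x (tright y a)"
  "tleft (mV x y) a = tleft x (tright y a) + mV x (tleft y a)"
proof -
  have "i (tright (mV x y) a) + j (tleft (mV x y) a) = j x *\<^sub>E (j y *\<^sub>E i a)"
    by (simp add: ji_mult[symmetric] j_simps E.assoc)
  also have "\<dots> = i (tright x (tright y a)) + j (tleft x (tright y a) + mV x (tleft y a))"
    by (simp add: ji_mult mE_simps j_simps ac_simps)
  finally show "tright (mV x y) a = tright x (tright y a)"
    "tleft (mV x y) a = tleft x (tright y a) + mV x (tleft y a)"
    by (simp_all add: sum_eq_iff)
qed

text \<open>Since \<open>i oneA\<close> is the unit of \<open>E\<close>, both products with
  \<open>j x\<close> equal \<open>i 0 + j x\<close>; the claims are the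
  \<open>V\<close>-components.\<close>

lemma unit_actions: "hright oneA x = x" "tleft x oneA = x"
proof -
  have "i (hleft oneA x) + j (hright oneA x) = i 0 + j x"
    by (simp add: ij_mult[symmetric] i_simps)
  then show "hright oneA x = x"
    unfolding sum_eq_iff by simp
  have "i (tright x oneA) + j (tleft x oneA) = i 0 + j x"
    by (simp add: ji_mult[symmetric] i_simps)
  then show "tleft x oneA = x"
    unfolding sum_eq_iff by simp
qed

text \<open>Both sides are coordinates of the same element, and coordinates are unique. With
  \<open>proj_scale\<close> this makes the actions bilinear.\<close>

lemma proj_add: "proj_A (e + f) = proj_A e + proj_A f" "proj_V (e + f) = proj_V e + proj_V f"
proof -
  have "i (proj_A (e + f)) + j (proj_V (e + f)) = (i (proj_A e) + j (proj_V e)) + (i (proj_A f) + j (proj_V f))"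
    by (simp only: sum_proj)
  also have "\<dots> = i (proj_A e + proj_A f) + j (proj_V e + proj_V f)"
    by (simp add: i_simps j_simps ac_simps)
  finally show "proj_A (e + f) = proj_A e + proj_A f" "proj_V (e + f) = proj_V e + proj_V f"
    by (simp_all add: sum_eq_iff)
qed

lemma proj_scale: "proj_A (sE c e) = sA c (proj_A e)" "proj_V (sE c e) = sV c (proj_V e)"
proof -
  have "i (proj_A (sE c e)) + j (proj_V (sE c e)) = sE c (i (proj_A e) + j (proj_V e))"
    by (simp only: sum_proj)
  also have "\<dots> = i (sA c (proj_A e)) + j (sV c (proj_V e))"
    by (simp add: i_simps j_simps E.scale_right_distrib)
  finally show "proj_A (sE c e) = sA c (proj_A e)" "proj_V (sE c e) = sV c (proj_V e)"
    by (simp_all add: sum_eq_iff)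
qed

lemma bilinear_actions:
  "bilinear_map sV sA sV tleft" "bilinear_map sV sA sA tright"
  "bilinear_map sA sV sA hleft" "bilinear_map sA sV sV hright"
  unfolding bilinear_map_iff tleft_def tright_def hleft_def hright_def
  by (simp_all add: i_simps j_simps mE_simps proj_add proj_scale
      A.vector_space_axioms V.vector_space_axioms)

lemma matched_pair: "matched_pair sA mA oneA sV mV tleft tright hleft hright"
  by unfold_locales
    (simp_all add: bilinear_actions mixed_iij mixed_iji mixed_jii mixed_ijj mixed_jij mixed_jji
      unit_actions)

lemma isomorphic_bicrossed:
  "unital_algebra_isomorphic sE mE oneE
    (module_prod.scale sA sV) (bicrossed_mult mA mV tleft tright hleft hright) (oneA, 0)"
proof -
  interpret AV: vector_space_prod sA sV ..
  \<comment> \<open>The isomorphism out of \<open>E\<close> is the inverse of the sum map.\<close>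
  let ?g = "\<lambda>e. (proj_A e, proj_V e)"
  have "?g = inv (\<lambda>(a, x). i a + j x)"
    by (simp add: fun_eq_iff proj_A_def proj_V_def)
  then have "bij ?g"
    using bij_imp_bij_inv[OF bij_sum] by simp
  moreover have "?g (e *\<^sub>E f) = bicrossed_mult mA mV tleft tright hleft hright (?g e) (?g f)" for e f
  proof -
    have "i (proj_A (e *\<^sub>E f)) + j (proj_V (e *\<^sub>E f)) =
        (i (proj_A e) + j (proj_V e)) *\<^sub>E (i (proj_A f) + j (proj_V f))"
      by (simp only: sum_proj)
    \<comment> \<open>Of the four products obtained by distributing, the pure ones are images under
      \<open>i\<close> or \<open>j\<close>; \<open>ij_mult\<close> and \<open>ji_mult\<close>
      decompose the mixed ones.\<close>
    also have "\<dots> =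
        i (mA (proj_A e) (proj_A f) + hleft (proj_A e) (proj_V f) + tright (proj_V e) (proj_A f)) +
        j (hright (proj_A e) (proj_V f) + tleft (proj_V e) (proj_A f) + mV (proj_V e) (proj_V f))"
      by (simp add: mE_simps i_simps j_simps ij_mult ji_mult ac_simps)
    finally show ?thesis
      by (simp add: bicrossed_mult_def sum_eq_iff)
  qed
  moreover have "?g oneE = (oneA, 0)"
    using sum_proj[of oneE] sum_eq_iff[of "proj_A oneE" "proj_V oneE" oneA 0]
    by (simp add: i_simps)
  moreover have "Vector_Spaces.linear sE AV.scale ?g"
    unfolding Vector_Spaces.linear_iff
    by (simp add: proj_add proj_scale AV.scale_def E.vector_space_axioms AV.p.vector_space_axioms)
  ultimately show ?thesis
    unfolding unital_algebra_isomorphic_def unital_algebra_hom_def algebra_hom_def by blast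
qed

end

text \<open>The copies \<open>B\<close> and \<open>W\<close> are the ranges of \<open>i\<close> and
  \<open>j\<close>, so \<open>B + W = E\<close> gives surjectivity of the sum map and the trivial
  intersection gives injectivity.\<close>

lemma factorizes_through_imp_splitting:
  assumes "unital_assoc_algebra sA mA oneA" "assoc_algebra sV mV" "unital_assoc_algebra sE mE oneE"
    and "factorizes_through sE mE oneE sA mA oneA sV mV"
  shows "\<exists>i j. algebra_splitting sA mA oneA sV mV sE mE oneE i j"
proof -
  interpret E: unital_assoc_algebra sE mE oneE by fact
  from assms(4) obtain B W i j where B: "E.subspace B" and W: "E.subspace W"
    and i: "unital_algebra_hom sA mA oneA sE mE oneE i" "bij_betw i UNIV B"
    and j: "algebra_hom sV mV sE mE j" "bij_betw j UNIV W"
    and sum: "{b + w |b w. b \<in> B \<and> w \<in> W} = UNIV" and int: "B \<inter> W = {0}"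
    unfolding factorizes_through_def unital_subalgebra_def subalgebra_def by blast
  have "inj (\<lambda>(a, x). i a + j x)"
  proof (rule injI, clarsimp)
    fix a x b y assume eq: "i a + j x = i b + j y"
    \<comment> \<open>Rearranging \<open>eq\<close> equates an element of \<open>B\<close> with one
      of \<open>W\<close>, so both differences vanish.\<close>
    have "i a - i b \<in> B" "j y - j x \<in> W"
      using i(2) j(2) B W by (auto intro!: E.subspace_diff simp: bij_betw_def)
    moreover have "i a - i b = j y - j x"
      using eq by (simp add: algebra_simps)
    ultimately have "i a - i b \<in> B \<inter> W"
      by simp
    with int eq have "i a = i b \<and> j x = j y"
      by simp
    then show "a = b \<and> x = y"
      using i(2) j(2) by (auto simp: bij_betw_def dest: injD)
  qed
  moreover have "surj (\<lambda>(a, x). i a + j x)"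
  proof -
    have "e \<in> range (\<lambda>(a, x). i a + j x)" for e
    proof -
      from sum have "e \<in> {b + w |b w. b \<in> B \<and> w \<in> W}"
        by simp
      then obtain b w where "e = b + w" "b \<in> range i" "w \<in> range j"
        using i(2) j(2) by (auto simp: bij_betw_def)
      then show ?thesis
        by (auto simp: image_iff)
    qed
    then show ?thesis by blast
  qed
  ultimately have "algebra_splitting sA mA oneA sV mV sE mE oneE i j"
    using assms(1-3) i(1) j(1) by (simp add: algebra_splitting_def algebra_splitting_axioms_def bij_def)
  then show ?thesis by blast
qed

section \<open>Ranges, composites and inverses of algebra homomorphisms\<close>

lemma subalgebra_range:
  assumes "algebra_hom s m s' m' f"
  shows "subalgebra s' m' (range f)"
proof -
  interpret Vector_Spaces.linear s s' f
    using assms by (simp add: algebra_hom_def)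
  show ?thesis
    using assms subspace_image[OF vs1.subspace_UNIV]
    by (auto simp: subalgebra_def algebra_hom_def) (metis rangeI)
qed

lemma algebra_hom_comp:
  assumes "algebra_hom s1 m1 s2 m2 f" "algebra_hom s2 m2 s3 m3 g"
  shows "algebra_hom s1 m1 s3 m3 (\<lambda>x. g (f x))"
  using assms unfolding algebra_hom_def Vector_Spaces.linear_iff by simp

lemma algebra_hom_inv:
  assumes "algebra_hom s1 m1 s2 m2 f" "bij f"
  shows "algebra_hom s2 m2 s1 m1 (inv f)"
proof -
  have lin: "Vector_Spaces.linear s2 s1 (inv f)"
    using assms bij_module_hom_imp_inv_module_hom
    by (auto simp: algebra_hom_def module_hom_iff_linear[symmetric] linear_iff_module_hom)
  have "inv f (m2 x y) = m1 (inv f x) (inv f y)" for x y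
  proof -
    have "f (m1 (inv f x) (inv f y)) = m2 x y"
      using assms by (simp add: algebra_hom_def bij_is_surj surj_f_inv_f)
    then show ?thesis
      using assms(2) by (metis bij_is_inj inv_f_f)
  qed
  with lin show ?thesis
    by (simp add: algebra_hom_def)
qed

section \<open>From a bicrossed product to a factorization\<close>

context matched_pair
begin

text \<open>With zero second entries, bilinearity removes every term of the product except
  \<open>mA a b\<close>.\<close>

lemma algebra_hom_bicrossed_left:
  "algebra_hom sA mA (module_prod.scale sA sV) (bicrossed_mult mA mV tleft tright hleft hright)
    (\<lambda>a. (a, 0))"
proof -
  interpret P: vector_space_prod sA sV ..
  show ?thesis
    unfolding algebra_hom_def Vector_Spaces.linear_iff
    by (simp add: P.scale_def P.p.vector_space_axioms A.vector_space_axioms bicrossed_mult_def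
        bilinear_map_zero[OF VA.bilinear_left] bilinear_map_zero[OF VA.bilinear_right]
        bilinear_map_zero[OF AV.bilinear_left] bilinear_map_zero[OF AV.bilinear_right]
        bilinear_map_zero[OF V.bilinear_mult])
qed

lemma algebra_hom_bicrossed_right:
  "algebra_hom sV mV (module_prod.scale sA sV) (bicrossed_mult mA mV tleft tright hleft hright)
    (\<lambda>x. (0, x))"
proof -
  interpret P: vector_space_prod sA sV ..
  show ?thesis
    unfolding algebra_hom_def Vector_Spaces.linear_iff
    by (simp add: P.scale_def P.p.vector_space_axioms V.vector_space_axioms bicrossed_mult_def
        bilinear_map_zero[OF VA.bilinear_left] bilinear_map_zero[OF VA.bilinear_right]
        bilinear_map_zero[OF AV.bilinear_left] bilinear_map_zero[OF AV.bilinear_right]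
        bilinear_map_zero[OF A.bilinear_mult])
qed

lemma isomorphic_bicrossed_imp_factorizes_through:
  assumes "unital_algebra_isomorphic sE mE oneE
    (module_prod.scale sA sV) (bicrossed_mult mA mV tleft tright hleft hright) (oneA, 0)"
  shows "factorizes_through sE mE oneE sA mA oneA sV mV"
proof -
  let ?s = "module_prod.scale sA sV" and ?m = "bicrossed_mult mA mV tleft tright hleft hright"
  from assms obtain f where f: "algebra_hom sE mE ?s ?m f" "f oneE = (oneA, 0)" "bij f"
    unfolding unital_algebra_isomorphic_def unital_algebra_hom_def by blast
  \<comment> \<open>The isomorphism is reversed because the copies of \<open>A\<close> and
    \<open>V\<close> have to lie in \<open>E\<close>.\<close>
  define g where "g = inv f"
  have g: "algebra_hom ?s ?m sE mE g" "bij g"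
    using f algebra_hom_inv bij_imp_bij_inv by (auto simp: g_def)
  have g_add: "g (p + q) = g p + g q" for p q
    using g(1) unfolding algebra_hom_def Vector_Spaces.linear_iff by blast
  have g_zero: "g 0 = 0"
    using g_add[of 0 0] by simp
  have g_one: "g (oneA, 0) = oneE"
    using f(2,3) by (metis bij_is_inj g_def inv_f_f)
  define i j where "i = (\<lambda>a. g (a, 0))" and "j = (\<lambda>x. g (0, x))"
  have i: "algebra_hom sA mA sE mE i"
    unfolding i_def by (rule algebra_hom_comp[OF algebra_hom_bicrossed_left g(1)])
  have j: "algebra_hom sV mV sE mE j"
    unfolding j_def by (rule algebra_hom_comp[OF algebra_hom_bicrossed_right g(1)])
  have inj: "inj i" "inj j"
    using bij_is_inj[OF g(2)] by (auto simp: i_def j_def inj_def)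
  have "e \<in> {b + w |b w. b \<in> range i \<and> w \<in> range j}" for e
  proof -
    obtain a x where "e = g (a, x)"
      using bij_is_surj[OF g(2)] by (metis surjD surj_pair)
    \<comment> \<open>Additivity of \<open>g\<close> applied to
      \<open>(a, x) = (a, 0) + (0, x)\<close>.\<close>
    then have "e = i a + j x"
      by (simp add: i_def j_def flip: g_add)
    then show ?thesis by blast
  qed
  then have "{b + w |b w. b \<in> range i \<and> w \<in> range j} = UNIV"
    by blast
  moreover have "range i \<inter> range j = {0}"
  proof -
    have "i 0 = 0" "j 0 = 0"
      using g_zero by (simp_all add: i_def j_def zero_prod_def)
    \<comment> \<open>Injectivity of \<open>g\<close> turns the premise into
      \<open>(a, 0) = (0, x)\<close>.\<close>
    moreover have "i a = j x \<Longrightarrow> a = 0" for a x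
      using bij_is_inj[OF g(2)] by (auto simp: i_def j_def dest: injD)
    ultimately show ?thesis
      by (auto simp: image_iff)
  qed
  moreover have "oneE \<in> range i" "i oneA = oneE"
    using g_one by (auto simp: i_def image_iff)
  ultimately show ?thesis
    unfolding factorizes_through_def unital_subalgebra_def unital_algebra_hom_def
    using i j subalgebra_range[OF i] subalgebra_range[OF j]
      inj_on_imp_bij_betw[OF inj(1)] inj_on_imp_bij_betw[OF inj(2)]
    by (intro exI[of _ "range i"] exI[of _ "range j"] conjI exI[of _ i] exI[of _ j]) assumption+
qed

end

theorem corollary2p10:
  fixes sA :: "'k::field \<Rightarrow> 'a::ab_group_add \<Rightarrow> 'a" and mA :: "'a \<Rightarrow> 'a \<Rightarrow> 'a" and oneA :: 'a
    and sV :: "'k \<Rightarrow> 'v::ab_group_add \<Rightarrow> 'v" and mV :: "'v \<Rightarrow> 'v \<Rightarrow> 'v"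
    and sE :: "'k \<Rightarrow> 'e::ab_group_add \<Rightarrow> 'e" and mE :: "'e \<Rightarrow> 'e \<Rightarrow> 'e" and oneE :: 'e
  assumes "unital_assoc_algebra sA mA oneA"
    and "assoc_algebra sV mV"
    and "unital_assoc_algebra sE mE oneE"
  shows "factorizes_through sE mE oneE sA mA oneA sV mV \<longleftrightarrow>
    (\<exists>tleft tright hleft hright.
       matched_pair sA mA oneA sV mV tleft tright hleft hright \<and>
       unital_algebra_isomorphic sE mE oneE
         (module_prod.scale sA sV) (bicrossed_mult mA mV tleft tright hleft hright) (oneA, 0))"
proof
  assume "factorizes_through sE mE oneE sA mA oneA sV mV"
  from factorizes_through_imp_splitting[OF assms this]
  obtain i j where "algebra_splitting sA mA oneA sV mV sE mE oneE i j"
    by blast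
  then interpret algebra_splitting sA mA oneA sV mV sE mE oneE i j .
  from matched_pair isomorphic_bicrossed
  show "\<exists>tleft tright hleft hright.
       matched_pair sA mA oneA sV mV tleft tright hleft hright \<and>
       unital_algebra_isomorphic sE mE oneE
         (module_prod.scale sA sV) (bicrossed_mult mA mV tleft tright hleft hright) (oneA, 0)"
    by blast
qed (elim exE conjE, rule matched_pair.isomorphic_bicrossed_imp_factorizes_through)

end
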